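(* Let $\mu,\mu'$ be probability measures on $\mathbb Z$ with supports $S_\mu\subset\mathbb Z^+$ and $S_{\mu'}\subset\mathbb Z^-$. The measure $\nu$ on $\mathbb Z$ given by $$\nu(m)=\begin{cases}\mu'\,]-\infty,m] & \text{if } m\le-1,\\ \mu\,[m+1,+\infty[ & \text{if } m\ge0,\end{cases}$$ is invariant for the Markov chain $\mathcal X^{(0)}(\mu,\mu')$. Moreover, for arbitrary $x_0\in\mathbb Z$, its restriction $\nu_{x_0}$ to the essential class $\mathcal I(r_{x_0})$ (i.e. $\nu_{x_0}(A)=\sum_{x\in A}\nu(x)$ for $A\subset\mathcal I(r_{x_0})$) is an invariant measure on $\mathcal I(r_{x_0})$.
   Context: $\mathbb Z^+$ (resp. $\mathbb Z^-$) is the set of positive (resp. negative) integers. $\delta$ is the greatest common divisor of $\gcd(S_\mu)$ and $\gcd(S_{\mu'})$, and $r_x$ is the remainder of $x$ modulo $\delta$, $0\le r_x<\delta$. The oscillating random walk $\mathcal X^{(0)}(\mu,\mu')=(X_n^{(0)})_{n\ge0}$ is the Markov chain on $\mathbb Z$ with $X_{n+1}^{(0)}=X_n^{(0)}+\xi_{n+1}$ if $X_n^{(0)}\le-1$ and $X_{n+1}^{(0)}=X_n^{(0)}+\xi'_{n+1}$ if $X_n^{(0)}\ge0$, where $(\xi_n,\xi_n')_{n\ge1}$ is i.i.d., $\xi_n$ has law $\mu$ and $\xi'_n$ has law $\mu'$. $\mathcal I(x)$ denotes the irreducible (communicating) class of $x$ for this chain; an essential class is a closed irreducible class. For $0\le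 r<\delta$, $\mathcal I(r)$ is essential and equals the set of integers $y\equiv r\pmod\delta$ with $\min S_{\mu'}\le y\le\max S_\mu-1$ (with $\min S_{\mu'}=-\infty$, $\max S_\mu=+\infty$ allowed). *)

theory Defs
  imports "HOL-Probability.Probability"
begin

text \<open>
  Probability measures on the integers are rendered by the type \<^typ>\<open>int pmf\<close>; the support
  is \<^const>\<open>set_pmf\<close>.  A time-homogeneous Markov chain on a countable set is given by its
  transition kernel \<open>K\<close>, where \<open>K x\<close> is the law of the next state from \<open>x\<close>.
\<close>

primrec kernel_pow :: "('a \<Rightarrow> 'a pmf) \<Rightarrow> nat \<Rightarrow> 'a \<Rightarrow> 'a pmf" where
  "kernel_pow K 0 x = return_pmf x"
| "kernel_pow K (Suc n) x = bind_pmf (kernel_pow K n x) K"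

definition accessible :: "('a \<Rightarrow> 'a pmf) \<Rightarrow> 'a \<Rightarrow> 'a \<Rightarrow> bool" where
  "accessible K x y \<longleftrightarrow> (\<exists>n. pmf (kernel_pow K n x) y > 0)"

definition irreducible_class :: "('a \<Rightarrow> 'a pmf) \<Rightarrow> 'a \<Rightarrow> 'a set" where
  "irreducible_class K x = {y. accessible K x y \<and> accessible K y x}"

definition closed_under :: "('a \<Rightarrow> 'a pmf) \<Rightarrow> 'a set \<Rightarrow> bool" where
  "closed_under K C \<longleftrightarrow> (\<forall>x\<in>C. set_pmf (K x) \<subseteq> C)"

definition essential_class :: "('a \<Rightarrow> 'a pmf) \<Rightarrow> 'a set \<Rightarrow> bool" where
  "essential_class K C \<longleftrightarrow> (\<exists>x. C = irreducible_class K x) \<and> closed_under K C"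

text \<open>
  The state space is \<open>space N\<close>, so an invariant measure on a subset \<open>C\<close> is a measure with space
  \<open>C\<close>; the kernel must then restrict to \<open>C\<close>.  The measure may be infinite, hence the
  extended nonnegative integral rather than the monadic bind, which is for subprobabilities.
\<close>

definition invariant_measure :: "('a \<Rightarrow> 'a pmf) \<Rightarrow> 'a measure \<Rightarrow> bool" where
  "invariant_measure K N \<longleftrightarrow>
     sets N = Pow (space N) \<and> closed_under K (space N) \<and>
     (\<forall>A. A \<subseteq> space N \<longrightarrow> (\<integral>\<^sup>+x. emeasure (K x) A \<partial>N) = emeasure N A)"

definition osc_step :: "int \<Rightarrow> int \<times> int \<Rightarrow> int" where
  "osc_step x z = (if x \<le> -1 then x + fst z else x + snd z)"

primrec osc_walk :: "int \<Rightarrow> (nat \<Rightarrow> 'w \<Rightarrow> int \<times> int) \<Rightarrow> nat \<Rightarrow> 'w \<Rightarrow> int" where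
  "osc_walk x0 Z 0 w = x0"
| "osc_walk x0 Z (Suc n) w = osc_step (osc_walk x0 Z n w) (Z (Suc n) w)"

definition osc_kernel :: "int pmf \<Rightarrow> int pmf \<Rightarrow> int \<Rightarrow> int pmf" where
  "osc_kernel \<mu> \<mu>' x = (if x \<le> -1 then map_pmf (\<lambda>s. x + s) \<mu> else map_pmf (\<lambda>s. x + s) \<mu>')"

text \<open>
  The walk driven by an i.i.d. sequence \<open>Z n = (\<xi>\<^sub>n, \<xi>'\<^sub>n)\<close> is a Markov chain with transition
  kernel \<^const>\<open>osc_kernel\<close>, whatever the joint law of \<open>\<xi>\<^sub>n\<close> and \<open>\<xi>'\<^sub>n\<close>.
\<close>

lemma (in prob_space) osc_walk_path_prob:
  assumes ind: "indep_vars (\<lambda>_. count_space UNIV) Z {1..}"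
    and fst: "\<And>n. n \<ge> 1 \<Longrightarrow> distr M (count_space UNIV) (\<lambda>w. fst (Z n w)) = measure_pmf \<mu>"
    and snd: "\<And>n. n \<ge> 1 \<Longrightarrow> distr M (count_space UNIV) (\<lambda>w. snd (Z n w)) = measure_pmf \<mu>'"
  shows "\<P>(w in M. \<forall>k\<le>n. osc_walk x0 Z k w = s k) =
    (if s 0 = x0 then \<Prod>k<n. pmf (osc_kernel \<mu> \<mu>' (s k)) (s (Suc k)) else 0)"
proof (cases "s 0 = x0")
  case False
  then have "{w\<in>space M. \<forall>k\<le>n. osc_walk x0 Z k w = s k} = {}" by fastforce
  with False show ?thesis by (simp only: if_False measure_empty)
next
  case True
  define A where "A k = {z. osc_step (s (k - 1)) z = s k}" for k
  have Zm: "Z k \<in> measurable M (count_space UNIV)" if "k \<ge> 1" for k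
    using ind that by (auto simp: indep_vars_def)
  have path: "(\<forall>k\<le>n. osc_walk x0 Z k w = s k) \<longleftrightarrow> (\<forall>k\<in>{1..n}. Z k w \<in> A k)" for w
  proof (induction n)
    case 0
    then show ?case using True by simp
  next
    case (Suc n)
    have "(\<forall>k\<le>Suc n. osc_walk x0 Z k w = s k) \<longleftrightarrow>
       (\<forall>k\<le>n. osc_walk x0 Z k w = s k) \<and> osc_walk x0 Z (Suc n) w = s (Suc n)"
      by (auto simp: le_Suc_eq)
    also have "\<dots> \<longleftrightarrow> (\<forall>k\<le>n. osc_walk x0 Z k w = s k) \<and> Z (Suc n) w \<in> A (Suc n)"
      by (auto simp: A_def)
    also have "\<dots> \<longleftrightarrow> (\<forall>k\<in>{1..Suc n}. Z k w \<in> A k)"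
      unfolding Suc.IH by (simp add: atLeastAtMostSuc_conv conj_commute)
    finally show ?case .
  qed
  have step: "prob (Z k -` A k \<inter> space M) = pmf (osc_kernel \<mu> \<mu>' (s (k - 1))) (s k)"
    if k: "k \<ge> 1" for k
  proof (cases "s (k - 1) \<le> -1")
    case neg: True
    have "Z k -` A k \<inter> space M = (\<lambda>w. fst (Z k w)) -` {s k - s (k - 1)} \<inter> space M"
      using neg by (auto simp: A_def osc_step_def)
    also have "prob \<dots> = measure (distr M (count_space UNIV) (\<lambda>w. fst (Z k w))) {s k - s (k - 1)}"
      by (subst measure_distr) (use Zm[OF k] in \<open>auto intro: measurable_compose\<close>)
    also have "\<dots> = pmf \<mu> (s k - s (k - 1))" using fst[OF k] by (simp add: pmf.rep_eq)
    also have "\<dots> = pmf (map_pmf (\<lambda>u. s (k-1) + u) \<mu>) (s (k - 1) + (s k - s (k - 1)))"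
      by (rule pmf_map_inj'[symmetric]) (auto simp: inj_def)
    finally show ?thesis using neg by (simp add: osc_kernel_def)
  next
    case neg: False
    have "Z k -` A k \<inter> space M = (\<lambda>w. snd (Z k w)) -` {s k - s (k - 1)} \<inter> space M"
      using neg by (auto simp: A_def osc_step_def)
    also have "prob \<dots> = measure (distr M (count_space UNIV) (\<lambda>w. snd (Z k w))) {s k - s (k - 1)}"
      by (subst measure_distr) (use Zm[OF k] in \<open>auto intro: measurable_compose\<close>)
    also have "\<dots> = pmf \<mu>' (s k - s (k - 1))" using snd[OF k] by (simp add: pmf.rep_eq)
    also have "\<dots> = pmf (map_pmf (\<lambda>u. s (k-1) + u) \<mu>') (s (k - 1) + (s k - s (k - 1)))"
      by (rule pmf_map_inj'[symmetric]) (auto simp: inj_def)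
    finally show ?thesis using neg by (simp add: osc_kernel_def)
  qed
  have "\<P>(w in M. \<forall>k\<le>n. osc_walk x0 Z k w = s k) = (\<Prod>k\<in>{1..n}. prob (Z k -` A k \<inter> space M))"
  proof (cases "n = 0")
    case True
    then show ?thesis using \<open>s 0 = x0\<close> by (simp add: prob_space)
  next
    case False
    have "{w\<in>space M. \<forall>k\<le>n. osc_walk x0 Z k w = s k} = (\<Inter>k\<in>{1..n}. Z k -` A k \<inter> space M)"
      unfolding path using False by (auto simp: Suc_le_eq)
    then show ?thesis
      using indep_varsD[OF ind, of "{1..n}" A] False by auto
  qed
  also have "\<dots> = (\<Prod>k\<in>{1..n}. pmf (osc_kernel \<mu> \<mu>' (s (k - 1))) (s k))"
    by (rule prod.cong) (auto simp: step)
  also have "\<dots> = (\<Prod>k<n. pmf (osc_kernel \<mu> \<mu>' (s k)) (s (Suc k)))"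
    by (rule prod.reindex_bij_witness[of _ Suc "\<lambda>k. k - 1"]) auto
  finally show ?thesis using True by simp
qed

definition osc_nu :: "int pmf \<Rightarrow> int pmf \<Rightarrow> int measure" where
  "osc_nu \<mu> \<mu>' = point_measure UNIV
     (\<lambda>m. if m \<le> -1 then emeasure \<mu>' {..m} else emeasure \<mu> {m+1..})"

definition osc_delta :: "int pmf \<Rightarrow> int pmf \<Rightarrow> int" where
  "osc_delta \<mu> \<mu>' = gcd (Gcd (set_pmf \<mu>)) (Gcd (set_pmf \<mu>'))"

end

theory Submission
  imports Defs "HOL-Number_Theory.Cong"
begin

text \<open>
  Let \<open>W\<close> be the set of integers of positive weight. It is closed, and steps preserve residues
  modulo \<open>\<delta>\<close>. Conversely, two points of \<open>W\<close> congruent modulo \<open>\<delta>\<close> communicate: for two jumps \<open>a > 0 > t\<close>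
  the walk on \<open>{t..<a}\<close> is a rotation modulo \<open>a - t\<close>, so points congruent modulo \<open>gcd a t\<close> communicate.
  Choosing \<open>a\<close> and \<open>-t\<close> large enough to dominate a finite set of jumps with greatest common divisor
  \<open>\<delta>\<close>, one can execute each of these jumps inside \<open>{t..<a}\<close> from a suitable representative modulo
  \<open>gcd a t\<close>. Hence the class of \<open>r\<close> is the residue class of \<open>r\<close> in \<open>W\<close>, and no mass of \<open>\<nu>\<close>
  enters it from outside, so that the restriction of \<open>\<nu>\<close> inherits invariance.
\<close>

section \<open>Accessibility\<close>

text \<open>Whether a state has positive probability depends only on the supports, so accessibility
  becomes reachability in a directed graph.\<close>

lemma accessible_iff_rtranclp:
  "accessible K x y \<longleftrightarrow> (\<lambda>u v. v \<in> set_pmf (K u))\<^sup>*\<^sup>* x y"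
proof
  have "y \<in> set_pmf (kernel_pow K n x) \<Longrightarrow> (\<lambda>u v. v \<in> set_pmf (K u))\<^sup>*\<^sup>* x y" for n
    by (induction n arbitrary: y) (auto intro: rtranclp.rtrancl_into_rtrancl)
  then show "accessible K x y \<Longrightarrow> (\<lambda>u v. v \<in> set_pmf (K u))\<^sup>*\<^sup>* x y"
    by (auto simp: accessible_def pmf_positive_iff)
next
  assume "(\<lambda>u v. v \<in> set_pmf (K u))\<^sup>*\<^sup>* x y"
  then have "\<exists>n. y \<in> set_pmf (kernel_pow K n x)"
  proof (induction rule: rtranclp_induct)
    case base
    have "x \<in> set_pmf (kernel_pow K 0 x)" by simp
    then show ?case by blast
  next
    case (step y z)
    then obtain n where "y \<in> set_pmf (kernel_pow K n x)" by blast
    with step have "z \<in> set_pmf (kernel_pow K (Suc n) x)" by auto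
    then show ?case by blast
  qed
  then show "accessible K x y" by (simp add: accessible_def pmf_positive_iff)
qed

lemma accessible_refl: "accessible K x x"
  by (simp add: accessible_iff_rtranclp)

lemma accessible_trans: "accessible K x y \<Longrightarrow> accessible K y z \<Longrightarrow> accessible K x z"
  by (auto simp: accessible_iff_rtranclp)

lemma accessible_step: "accessible K x y \<Longrightarrow> z \<in> set_pmf (K y) \<Longrightarrow> accessible K x z"
  unfolding accessible_iff_rtranclp by (rule rtranclp.rtrancl_into_rtrancl)

lemma accessible_closed_under:
  assumes "closed_under K C" "accessible K x y" "x \<in> C"
  shows "y \<in> C"
  using assms(2,3) unfolding accessible_iff_rtranclp
  by (induction rule: rtranclp_induct) (use assms(1) in \<open>auto simp: closed_under_def\<close>)

lemma set_pmf_osc_kernel: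
  "set_pmf (osc_kernel \<mu> \<mu>' x) = (\<lambda>s. x + s) ` (if x \<le> -1 then set_pmf \<mu> else set_pmf \<mu>')"
  by (simp add: osc_kernel_def)

section \<open>Greatest common divisors of sets of integers\<close>

text \<open>Supports may be infinite; passing to finitely many jumps later lets one jump of each
  sign dominate them all.\<close>

lemma finite_subset_Gcd_eq:
  fixes S :: "int set"
  obtains F where "finite F" "F \<subseteq> S" "Gcd F = Gcd S"
proof (cases "S \<subseteq> {0}")
  case True
  then have "Gcd S = 0" by (simp add: Gcd_0_iff)
  then show ?thesis using that[of "{}"] by simp
next
  case False
  then obtain z where z: "z \<in> S" "z \<noteq> 0" by auto
  \<comment> \<open>Take a finite set of least gcd: adjoining an element of \<open>S\<close> cannot
    lower the gcd, which therefore divides that element. The condition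
    \<open>Gcd F \<noteq> 0\<close> excludes the empty set, whose gcd 0 would be the least
    number.\<close>
  let ?P = "\<lambda>F. finite F \<and> F \<subseteq> S \<and> Gcd F \<noteq> 0"
  have "?P {z}" using z by simp
  from ex_has_least_nat[of ?P "{z}" "\<lambda>F. nat (Gcd F)", OF this]
  obtain F where F: "?P F" and least: "\<And>G. ?P G \<Longrightarrow> nat (Gcd F) \<le> nat (Gcd G)"
    by blast
  have "Gcd F dvd s" if "s \<in> S" for s
  proof -
    have "?P (insert s F)" using F that by auto
    from least[OF this] have "Gcd F \<le> gcd s (Gcd F)"
      using F by (simp add: nat_le_eq_zle)
    moreover have "gcd s (Gcd F) \<le> Gcd F"
      using F by (intro zdvd_imp_le) (auto simp: less_le)
    ultimately have "gcd s (Gcd F) = Gcd F" by simp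
    then show ?thesis by (metis gcd_dvd1)
  qed
  then have "Gcd F dvd Gcd S" by (rule Gcd_greatest)
  moreover have "Gcd S dvd Gcd F" using F by (auto intro: Gcd_greatest Gcd_dvd)
  ultimately have "Gcd F = Gcd S" by (simp add: zdvd_antisym_nonneg)
  then show ?thesis using that F by blast
qed

text \<open>Here \<open>P\<close> describes a subgroup of the integers; it is applied below to the
  periods of a reachability predicate.\<close>

lemma dvd_in_int_subgroup:
  fixes P :: "int \<Rightarrow> bool"
  assumes zero: "P 0" and diff: "\<And>h k. P h \<Longrightarrow> P k \<Longrightarrow> P (h - k)"
    and "P g" and "g dvd h"
  shows "P h"
proof -
  have minus: "P (- k)" if "P k" for k using diff[OF zero that] by simp
  have add: "P (h + k)" if "P h" "P k" for h k using diff[OF that(1) minus[OF that(2)]] by simp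
  have nat: "P (int n * g)" for n
    by (induction n) (auto simp: zero algebra_simps intro: add \<open>P g\<close>)
  obtain q where q: "h = q * g" using \<open>g dvd h\<close> by (metis dvdE mult.commute)
  show ?thesis
  proof (cases q rule: int_cases2)
    case (nonneg n) then show ?thesis using nat q by simp
  next
    case (nonpos n) then show ?thesis using minus[OF nat[of n]] q by simp
  qed
qed

text \<open>Bezout, adjoining one generator at a time.\<close>

lemma Gcd_in_int_subgroup:
  fixes P :: "int \<Rightarrow> bool"
  assumes zero: "P 0" and diff: "\<And>h k. P h \<Longrightarrow> P k \<Longrightarrow> P (h - k)"
    and "finite F" and "\<And>s. s \<in> F \<Longrightarrow> P s"
  shows "P (Gcd F)"
  using assms(3,4)
proof (induction F rule: finite_induct)
  case empty
  then show ?case using zero by simp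
next
  case (insert s F)
  obtain u v where uv: "u * s + v * Gcd F = gcd s (Gcd F)" using bezout_int by blast
  have "P (u * s)" by (rule dvd_in_int_subgroup[of P s]) (use zero diff insert in auto)
  moreover have "P (- (v * Gcd F))"
    by (rule dvd_in_int_subgroup[of P "Gcd F"]) (use zero diff insert in auto)
  ultimately have "P (u * s - - (v * Gcd F))" by (rule diff)
  then show ?case using uv by simp
qed

section \<open>The irreducible classes\<close>

text \<open>This is the interval from the minimum of the support of \<mu>' to the maximum of that of
  \<mu> minus 1; the existential form covers unbounded supports as well.\<close>

definition osc_window :: "int pmf \<Rightarrow> int pmf \<Rightarrow> int set" where
  "osc_window \<mu> \<mu>' = {m. (\<exists>t\<in>set_pmf \<mu>'. t \<le> m) \<and> (\<exists>s\<in>set_pmf \<mu>. m < s)}"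

text \<open>
  If only the jumps \<open>a\<close> and \<open>t\<close> are used, the walk is the rotation \<open>z \<mapsto> z + a\<close> modulo \<open>a - t\<close>
  on \<open>{t..<a}\<close>.
\<close>

lemma accessible_two_jumps:
  assumes a: "a \<in> set_pmf \<mu>" "0 < a" and t: "t \<in> set_pmf \<mu>'" "t < 0"
    and x: "x \<in> {t..<a}" and y: "y \<in> {t..<a}" and cong: "gcd a t dvd y - x"
  shows "accessible (osc_kernel \<mu> \<mu>') x y"
proof -
  \<comment> \<open>Since \<open>a\<close> and \<open>t\<close> agree modulo \<open>a - t\<close>,
    each step adds \<open>a\<close> modulo \<open>a - t\<close>, whichever jump is taken.\<close>
  have orbit: "\<exists>z\<in>{t..<a}. accessible (osc_kernel \<mu> \<mu>') x z \<and> a - t dvd z - (x + int n * a)" for n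
  proof (induction n)
    case 0
    then show ?case using x by (intro bexI[of _ x]) (simp_all add: accessible_refl)
  next
    case (Suc n)
    then obtain z where z: "z \<in> {t..<a}" "accessible (osc_kernel \<mu> \<mu>') x z"
      "a - t dvd z - (x + int n * a)" by blast
    define w where "w = (if z \<le> -1 then z + a else z + t)"
    have "w \<in> set_pmf (osc_kernel \<mu> \<mu>' z)"
      using a t by (auto simp: set_pmf_osc_kernel w_def)
    then have "accessible (osc_kernel \<mu> \<mu>') x w" by (rule accessible_step[OF z(2)])
    moreover have "w \<in> {t..<a}" using z a t by (auto simp: w_def)
    moreover have "w - (x + int (Suc n) * a) =
        z - (x + int n * a) - (if z \<le> -1 then 0 else 1) * (a - t)"
      by (simp add: w_def algebra_simps)
    then have "a - t dvd w - (x + int (Suc n) * a)" using z(3) by (metis dvd_diff dvd_triv_right)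
    ultimately show ?case by blast
  qed
  obtain q where q: "y - x = gcd a t * q" using cong by blast
  \<comment> \<open>So every multiple of \<open>gcd a t\<close> is a multiple of \<open>a\<close>
    modulo \<open>a - t\<close>. Reducing \<open>k * q\<close> modulo \<open>a - t\<close> makes the
    coefficient nonnegative, hence a number of steps.\<close>
  have "gcd a (a - t) = gcd a t" using gcd_diff2[of a t] by (simp add: gcd.commute)
  then obtain k where k: "[a * k = gcd a t] (mod (a - t))"
    using cong_solve_int[of a "a - t"] by auto
  define n where "n = nat ((k * q) mod (a - t))"
  have "int n = (k * q) mod (a - t)" using a t by (simp add: n_def)
  then have "[int n * a = k * q * a] (mod (a - t))" by (simp add: cong_def mod_mult_left_eq)
  also have "[k * q * a = gcd a t * q] (mod (a - t))"
    using cong_scalar_right[OF k, of q] by (simp add: ac_simps)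
  finally have n: "a - t dvd int n * a - (y - x)" by (simp add: q cong_iff_dvd_diff)
  from orbit[of n] obtain z where z: "z \<in> {t..<a}" "accessible (osc_kernel \<mu> \<mu>') x z"
      "a - t dvd z - (x + int n * a)" by blast
  have "a - t dvd z - y" using dvd_add[OF z(3) n] by (simp add: algebra_simps)
  moreover have "\<bar>z - y\<bar> < \<bar>a - t\<bar>" using z(1) y by auto
  ultimately have "z = y" using dvd_imp_le_int[of "z - y" "a - t"] by linarith
  then show ?thesis using z by simp
qed

lemma accessible_if_cong:
  assumes pos: "set_pmf \<mu> \<subseteq> {0<..}" and neg: "set_pmf \<mu>' \<subseteq> {..<0}"
    and x: "x \<in> osc_window \<mu> \<mu>'" and y: "y \<in> osc_window \<mu> \<mu>'"
    and cong: "osc_delta \<mu> \<mu>' dvd y - x"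
  shows "accessible (osc_kernel \<mu> \<mu>') x y"
proof -
  let ?acc = "accessible (osc_kernel \<mu> \<mu>')"
  obtain F where F: "finite F" "F \<subseteq> set_pmf \<mu> \<union> set_pmf \<mu>'"
    "Gcd F = Gcd (set_pmf \<mu> \<union> set_pmf \<mu>')" by (rule finite_subset_Gcd_eq)
  have "osc_delta \<mu> \<mu>' = Gcd F"
    unfolding F(3) osc_delta_def
    by (rule Gcd_eqI[symmetric]) (auto intro: dvd_trans[OF _ Gcd_dvd] Gcd_greatest)
  obtain sx sy where s: "sx \<in> set_pmf \<mu>" "x < sx" "sy \<in> set_pmf \<mu>" "y < sy"
    using x y by (auto simp: osc_window_def)
  obtain tx ty where t: "tx \<in> set_pmf \<mu>'" "tx \<le> x" "ty \<in> set_pmf \<mu>'" "ty \<le> y"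
    using x y by (auto simp: osc_window_def)
  \<comment> \<open>The witnesses for \<open>x\<close> and \<open>y\<close> put both points into
    \<open>{b..<a}\<close>; the jumps of \<open>F\<close> are included so that each of them can be
    executed inside this interval.\<close>
  define a where "a = Max ({sx, sy} \<union> F \<inter> set_pmf \<mu>)"
  define b where "b = Min ({tx, ty} \<union> F \<inter> set_pmf \<mu>')"
  have a_in: "a \<in> {sx, sy} \<union> F \<inter> set_pmf \<mu>" unfolding a_def using F(1) by (intro Max_in) auto
  have b_in: "b \<in> {tx, ty} \<union> F \<inter> set_pmf \<mu>'" unfolding b_def using F(1) by (intro Min_in) auto
  have a: "a \<in> set_pmf \<mu>" "0 < a" and b: "b \<in> set_pmf \<mu>'" "b < 0"
    using a_in b_in s t pos neg by auto
  have a_ge: "s \<le> a" if "s \<in> {sx, sy} \<union> F \<inter> set_pmf \<mu>" for s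
    unfolding a_def using F(1) that by (intro Max_ge) auto
  have b_le: "b \<le> t" if "t \<in> {tx, ty} \<union> F \<inter> set_pmf \<mu>'" for t
    unfolding b_def using F(1) that by (intro Min_le) auto
  have xw: "x \<in> {b..<a}" and yw: "y \<in> {b..<a}"
    using a_ge[of sx] a_ge[of sy] b_le[of tx] b_le[of ty] s t by auto
  \<comment> \<open>Because \<open>d \<le> a\<close> and \<open>d \<le> - b\<close>, the interval
    contains a complete residue system modulo \<open>d\<close> on each side of zero.\<close>
  define d where "d = gcd a b"
  have d: "0 < d" "d \<le> a" "d \<le> - b"
    using a b by (auto simp: d_def intro: zdvd_imp_le)
  have rot: "?acc u v" if "u \<in> {b..<a}" "v \<in> {b..<a}" "d dvd v - u" for u v
    using accessible_two_jumps[OF a b] that by (simp add: d_def)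
  have rep: "\<exists>v\<in>{c..<c + d}. d dvd v - u" for u c :: int
  proof
    show "c + (u - c) mod d \<in> {c..<c + d}" using d by auto
    show "d dvd c + (u - c) mod d - u"
      by (simp add: mod_eq_dvd_iff[symmetric] mod_add_right_eq)
  qed

  \<comment> \<open>\<open>Q\<close> records which residues modulo \<open>d\<close> are reachable
    from \<open>x\<close>. By \<open>rot\<close>, reaching one representative in the interval means
    reaching all of them.\<close>
  define Q where "Q u = (\<exists>v\<in>{b..<a}. d dvd v - u \<and> ?acc x v)" for u
  have Q_acc: "?acc x v" if Qu: "Q u" and v: "v \<in> {b..<a}" and duv: "d dvd v - u" for u v
  proof -
    obtain w where w: "w \<in> {b..<a}" "d dvd w - u" "?acc x w" using Qu unfolding Q_def by blast
    have "d dvd v - w" using dvd_diff[OF duv w(2)] by simp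
    then show ?thesis using rot[OF w(1) v] accessible_trans[OF w(3)] by simp
  qed
  have Q_cong: "Q v" if Qu: "Q u" and duv: "d dvd v - u" for u v
  proof -
    obtain w where w: "w \<in> {b..<a}" "d dvd w - u" "?acc x w" using Qu unfolding Q_def by blast
    have "d dvd w - v" using dvd_diff[OF w(2) duv] by simp
    then show ?thesis using w unfolding Q_def by blast
  qed
  have Q_step: "Q (u + s)" if "Q u" "s \<in> F" for u s
  proof (cases "s \<in> set_pmf \<mu>")
    case True
    \<comment> \<open>A negative representative moves by \<mu>, and \<open>v < 0 < s \<le> a\<close>
      keeps \<open>v + s\<close> in the interval. The other case is symmetric, with a nonnegative
      representative and \<open>b \<le> s < 0\<close>.\<close>
    obtain v where v: "v \<in> {b..<b + d}" "d dvd v - u" using rep by blast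
    then have "?acc x v" using Q_acc[OF that(1)] d a by auto
    moreover have "v + s \<in> set_pmf (osc_kernel \<mu> \<mu>' v)"
      using True v d by (auto simp: set_pmf_osc_kernel)
    ultimately have "?acc x (v + s)" by (rule accessible_step)
    moreover have "v + s \<in> {b..<a}" using v d True a_ge[of s] that(2) pos by auto
    ultimately show ?thesis using v unfolding Q_def by (intro bexI[of _ "v + s"]) auto
  next
    case False
    then have s: "s \<in> set_pmf \<mu>'" using that F by auto
    obtain v where v: "v \<in> {0..<0 + d}" "d dvd v - u" using rep by blast
    then have "?acc x v" using Q_acc[OF that(1)] d b by auto
    moreover have "v + s \<in> set_pmf (osc_kernel \<mu> \<mu>' v)"
      using s v d by (auto simp: set_pmf_osc_kernel)
    ultimately have "?acc x (v + s)" by (rule accessible_step)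
    moreover have "v + s \<in> {b..<a}" using v d s b_le[of s] that(2) neg by auto
    ultimately show ?thesis using v unfolding Q_def by (intro bexI[of _ "v + s"]) auto
  qed
  have Q_back: "Q u" if "Q (u + s)" "s \<in> F" for u s
  proof -
    \<comment> \<open>A jump is undone by repeating it: \<open>d\<close> copies of \<open>s\<close>
      amount to 0 modulo \<open>d\<close>.\<close>
    have "Q (u + s + int n * s)" for n
      using that(1)
    proof (induction n)
      case (Suc n)
      then show ?case using Q_step[of "u + s + int n * s", OF _ that(2)] by (simp add: algebra_simps)
    qed simp
    from this[of "nat (d - 1)"] have "Q (u + d * s)" using d by (simp add: algebra_simps)
    then show ?thesis by (rule Q_cong) simp
  qed
  \<comment> \<open>The periods of \<open>Q\<close> form a subgroup containing \<open>F\<close>,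
    hence also \<open>y - x\<close>, a multiple of \<open>Gcd F\<close>.\<close>
  define P where "P h \<longleftrightarrow> (\<forall>u. Q u \<longleftrightarrow> Q (u + h))" for h
  have zero: "P 0" by (simp add: P_def)
  have diff: "P (h - k)" if "P h" "P k" for h k
    unfolding P_def
  proof
    fix u
    have "Q (u + (h - k)) \<longleftrightarrow> Q (u + (h - k) + k)" using that(2) unfolding P_def by blast
    also have "\<dots> \<longleftrightarrow> Q u" using that(1) by (simp add: P_def)
    finally show "Q u \<longleftrightarrow> Q (u + (h - k))" by blast
  qed
  have gen: "P s" if "s \<in> F" for s
    unfolding P_def using Q_step[OF _ that] Q_back[OF _ that] by blast
  have "Gcd F dvd y - x" using cong \<open>osc_delta \<mu> \<mu>' = Gcd F\<close> by simp
  with zero diff Gcd_in_int_subgroup[of P F, OF zero diff F(1) gen] have "P (y - x)"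
    by (rule dvd_in_int_subgroup[of P])
  moreover have "Q x" unfolding Q_def by (intro bexI[OF _ xw]) (simp add: accessible_refl)
  ultimately have "Q (x + (y - x))" unfolding P_def by blast
  then have "Q y" by simp
  then show ?thesis using yw by (rule Q_acc) simp
qed

text \<open>From \<open>x \<le> -1\<close> a jump \<open>s'\<close> lands below \<open>s'\<close>
  itself, so the jump just taken is the new upper witness while the old lower one survives. The
  other side is symmetric.\<close>

lemma osc_window_closed:
  assumes pos: "set_pmf \<mu> \<subseteq> {0<..}" and neg: "set_pmf \<mu>' \<subseteq> {..<0}"
  shows "closed_under (osc_kernel \<mu> \<mu>') (osc_window \<mu> \<mu>')"
  unfolding closed_under_def
proof (intro ballI subsetI)
  fix x y assume x: "x \<in> osc_window \<mu> \<mu>'" and y: "y \<in> set_pmf (osc_kernel \<mu> \<mu>' x)"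
  from x obtain s t where st: "s \<in> set_pmf \<mu>" "x < s" "t \<in> set_pmf \<mu>'" "t \<le> x"
    by (auto simp: osc_window_def)
  show "y \<in> osc_window \<mu> \<mu>'"
  proof (cases "x \<le> -1")
    case True
    then obtain s' where s': "s' \<in> set_pmf \<mu>" "y = x + s'" using y by (auto simp: set_pmf_osc_kernel)
    then have "t \<le> y" "y < s'" using True st pos by auto
    then show ?thesis using s' st unfolding osc_window_def by blast
  next
    case False
    then obtain t' where t': "t' \<in> set_pmf \<mu>'" "y = x + t'" using y by (auto simp: set_pmf_osc_kernel)
    then have "t' \<le> y" "y < s" using False st neg by auto
    then show ?thesis using t' st unfolding osc_window_def by blast
  qed
qed

lemma osc_delta_dvd_step:
  assumes "y \<in> set_pmf (osc_kernel \<mu> \<mu>' x)"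
  shows "osc_delta \<mu> \<mu>' dvd y - x"
proof -
  have "y - x \<in> set_pmf \<mu> \<or> y - x \<in> set_pmf \<mu>'"
    using assms by (auto simp: set_pmf_osc_kernel split: if_splits)
  then show ?thesis unfolding osc_delta_def by (meson Gcd_dvd dvd_trans gcd_dvd1 gcd_dvd2)
qed

lemma osc_delta_pos:
  assumes "set_pmf \<mu> \<subseteq> {0<..}"
  shows "0 < osc_delta \<mu> \<mu>'"
proof -
  obtain s where "s \<in> set_pmf \<mu>" using set_pmf_not_empty by fast
  then have "Gcd (set_pmf \<mu>) \<noteq> 0" using assms by (auto simp: Gcd_0_iff)
  then show ?thesis by (simp add: osc_delta_def)
qed

text \<open>The right-hand side is closed under the kernel, which confines the class; congruence is
  symmetric, so \<open>accessible_if_cong\<close> gives communication both ways.\<close>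

lemma irreducible_class_osc:
  assumes pos: "set_pmf \<mu> \<subseteq> {0<..}" and neg: "set_pmf \<mu>' \<subseteq> {..<0}"
    and r: "r \<in> osc_window \<mu> \<mu>'"
  shows "irreducible_class (osc_kernel \<mu> \<mu>') r =
    {y \<in> osc_window \<mu> \<mu>'. osc_delta \<mu> \<mu>' dvd y - r}" (is "_ = ?C")
proof
  have "closed_under (osc_kernel \<mu> \<mu>') ?C"
    unfolding closed_under_def
  proof (intro ballI subsetI)
    fix x y assume xy: "x \<in> ?C" "y \<in> set_pmf (osc_kernel \<mu> \<mu>' x)"
    then have "osc_delta \<mu> \<mu>' dvd (y - x) + (x - r)"
      using osc_delta_dvd_step[of y \<mu> \<mu>' x] by (intro dvd_add) auto
    then show "y \<in> ?C" using xy osc_window_closed[OF pos neg] by (auto simp: closed_under_def)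
  qed
  then have "y \<in> ?C" if "accessible (osc_kernel \<mu> \<mu>') r y" for y
    by (rule accessible_closed_under[OF _ that]) (simp add: r)
  then show "irreducible_class (osc_kernel \<mu> \<mu>') r \<subseteq> ?C"
    unfolding irreducible_class_def by blast
  show "?C \<subseteq> irreducible_class (osc_kernel \<mu> \<mu>') r"
  proof
    fix y assume "y \<in> ?C"
    then have y: "y \<in> osc_window \<mu> \<mu>'" "osc_delta \<mu> \<mu>' dvd y - r" by auto
    then have "osc_delta \<mu> \<mu>' dvd r - y" by (subst dvd_diff_commute)
    then show "y \<in> irreducible_class (osc_kernel \<mu> \<mu>') r"
      using accessible_if_cong[OF pos neg r y] accessible_if_cong[OF pos neg y(1) r]
      by (simp add: irreducible_class_def)
  qed
qed

text \<open>A positive jump is a multiple of \<open>osc_delta\<close>, so it exceeds every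
  remainder; a negative jump lies below all of them.\<close>

lemma mod_osc_delta_in_window:
  assumes pos: "set_pmf \<mu> \<subseteq> {0<..}" and neg: "set_pmf \<mu>' \<subseteq> {..<0}"
  shows "x mod osc_delta \<mu> \<mu>' \<in> osc_window \<mu> \<mu>'"
proof -
  obtain s t where st: "s \<in> set_pmf \<mu>" "t \<in> set_pmf \<mu>'" by (meson ex_in_conv set_pmf_not_empty)
  have d: "0 < osc_delta \<mu> \<mu>'" using pos by (rule osc_delta_pos)
  have "osc_delta \<mu> \<mu>' dvd s" using st by (auto simp: osc_delta_def intro: dvd_trans[OF _ Gcd_dvd])
  then have "osc_delta \<mu> \<mu>' \<le> s" using st pos by (intro zdvd_imp_le) auto
  then have "x mod osc_delta \<mu> \<mu>' < s" using pos_mod_bound[OF d, of x] by simp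
  moreover have "t \<le> x mod osc_delta \<mu> \<mu>'" using pos_mod_sign[OF d, of x] st neg by force
  ultimately show ?thesis using st by (auto simp: osc_window_def)
qed

section \<open>Invariance\<close>

definition osc_weight :: "int pmf \<Rightarrow> int pmf \<Rightarrow> int \<Rightarrow> ennreal" where
  "osc_weight \<mu> \<mu>' m = (if m \<le> -1 then emeasure \<mu>' {..m} else emeasure \<mu> {m+1..})"

lemma osc_nu_eq: "osc_nu \<mu> \<mu>' = density (count_space UNIV) (osc_weight \<mu> \<mu>')"
  by (simp add: osc_nu_def point_measure_def osc_weight_def[abs_def])

lemma emeasure_pmf_zero_iff: "emeasure (measure_pmf p) A = 0 \<longleftrightarrow> set_pmf p \<inter> A = {}"
  by (simp add: measure_pmf.emeasure_eq_measure measure_pmf_zero_iff)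

text \<open>On each side of zero the weight tests one of the two window conditions; the other holds
  there by the sign of the jumps.\<close>

lemma osc_weight_nonzero_iff:
  assumes pos: "set_pmf \<mu> \<subseteq> {0<..}" and neg: "set_pmf \<mu>' \<subseteq> {..<0}"
  shows "osc_weight \<mu> \<mu>' m \<noteq> 0 \<longleftrightarrow> m \<in> osc_window \<mu> \<mu>'"
proof -
  obtain s t where st: "s \<in> set_pmf \<mu>" "t \<in> set_pmf \<mu>'" by (meson ex_in_conv set_pmf_not_empty)
  have "emeasure \<mu>' {..m} \<noteq> 0 \<longleftrightarrow> (\<exists>t\<in>set_pmf \<mu>'. t \<le> m)"
    by (auto simp: emeasure_pmf_zero_iff)
  moreover have "emeasure \<mu> {m+1..} \<noteq> 0 \<longleftrightarrow> (\<exists>s\<in>set_pmf \<mu>. m < s)"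
    by (force simp: emeasure_pmf_zero_iff)
  ultimately show ?thesis using st pos neg by (force simp: osc_weight_def osc_window_def)
qed

lemma nn_integral_pmf_swap:
  "(\<integral>\<^sup>+a. \<integral>\<^sup>+b. f a b \<partial>measure_pmf q \<partial>measure_pmf p) =
   (\<integral>\<^sup>+b. \<integral>\<^sup>+a. f a b \<partial>measure_pmf p \<partial>measure_pmf q)"
proof -
  have "(\<integral>\<^sup>+a. \<integral>\<^sup>+b. f a b \<partial>measure_pmf q \<partial>measure_pmf p) = (\<integral>\<^sup>+(a, b). f a b \<partial>pair_pmf p q)"
    by (simp add: nn_integral_pair_pmf')
  also have "\<dots> = (\<integral>\<^sup>+(b, a). f a b \<partial>pair_pmf q p)"
    by (subst pair_commute_pmf) (simp add: case_prod_unfold)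
  finally show ?thesis by (simp add: nn_integral_pair_pmf')
qed

text \<open>The substitution \<open>x = y - s\<close> turns the mass arriving at \<open>y\<close>
  into an average over the last jump.\<close>

lemma nn_integral_convolution_pmf:
  fixes y :: int
  shows "(\<integral>\<^sup>+x. g x * ennreal (pmf p (y - x)) \<partial>count_space UNIV) = (\<integral>\<^sup>+s. g (y - s) \<partial>measure_pmf p)"
proof -
  have "bij (\<lambda>s. y - s)" by (rule bij_betw_byWitness[of _ "\<lambda>s. y - s"]) auto
  from nn_integral_bij_count_space[OF this, of "\<lambda>x. g x * ennreal (pmf p (y - x))"]
  show ?thesis by (simp add: nn_integral_measure_pmf mult.commute)
qed

lemma pmf_osc_kernel:
  "pmf (osc_kernel \<mu> \<mu>' x) y = pmf (if x \<le> -1 then \<mu> else \<mu>') (y - x)"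
proof -
  have "pmf (map_pmf (\<lambda>s. x + s) p) (x + (y - x)) = pmf p (y - x)" for p :: "int pmf"
    by (rule pmf_map_inj') (auto simp: inj_def)
  then show ?thesis by (simp add: osc_kernel_def)
qed

text \<open>
  For independent jumps \<open>t < 0 < s\<close>, the mass reaching \<open>y\<close> from the left comes from
  \<open>s + t \<le> y < s\<close> and the mass from the right from \<open>t \<le> y < s + t\<close>; together these events form
  \<open>t \<le> y < s\<close>, whose probability is the weight of \<open>y\<close>.
\<close>

lemma osc_weight_balance:
  assumes pos: "set_pmf \<mu> \<subseteq> {0<..}" and neg: "set_pmf \<mu>' \<subseteq> {..<0}"
  shows "(\<integral>\<^sup>+x. osc_weight \<mu> \<mu>' x * pmf (osc_kernel \<mu> \<mu>' x) y \<partial>count_space UNIV) = osc_weight \<mu> \<mu>' y"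
proof -
  \<comment> \<open>The weight is split at zero because the jump law changes there; the inflow into
    \<open>y\<close> is then a sum of two convolutions.\<close>
  define L where "L x = (if x \<le> -1 then emeasure \<mu>' {..x} else 0)" for x :: int
  define R where "R x = (if x \<le> -1 then 0 else emeasure \<mu> {x+1..})" for x :: int
  have ind: "emeasure (measure_pmf p) A = (\<integral>\<^sup>+s. of_bool (s \<in> A) \<partial>measure_pmf p)"
    for p :: "int pmf" and A
  proof -
    have "(\<integral>\<^sup>+s. of_bool (s \<in> A) \<partial>measure_pmf p) = (\<integral>\<^sup>+s. indicator A s \<partial>measure_pmf p)"
      by (intro nn_integral_cong) (simp add: indicator_def)
    then show ?thesis by simp
  qed
  have L: "(\<integral>\<^sup>+s. L (y - s) \<partial>measure_pmf \<mu>) =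
    (\<integral>\<^sup>+s. \<integral>\<^sup>+t. of_bool (s + t \<le> y \<and> y < s) \<partial>measure_pmf \<mu>' \<partial>measure_pmf \<mu>)"
  proof (rule nn_integral_cong)
    fix s
    show "L (y - s) = (\<integral>\<^sup>+t. of_bool (s + t \<le> y \<and> y < s) \<partial>measure_pmf \<mu>')"
    \<comment> \<open>The origin \<open>y - s\<close> is a left state exactly when
      \<open>y < s\<close>; otherwise both sides vanish. Likewise, \<open>y - t\<close> below is a
      right state exactly when \<open>t \<le> y\<close>.\<close>
    proof (cases "y < s")
      case True
      then have "L (y - s) = (\<integral>\<^sup>+t. of_bool (t \<in> {..y - s}) \<partial>measure_pmf \<mu>')"
        unfolding L_def ind[symmetric] by simp
      also have "(\<lambda>t. of_bool (t \<in> {..y - s})) = (\<lambda>t. of_bool (s + t \<le> y \<and> y < s) :: ennreal)"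
        using True by (intro ext) (simp add: algebra_simps)
      finally show ?thesis .
    qed (simp add: L_def)
  qed
  have R: "(\<integral>\<^sup>+t. R (y - t) \<partial>measure_pmf \<mu>') =
    (\<integral>\<^sup>+t. \<integral>\<^sup>+s. of_bool (t \<le> y \<and> y < s + t) \<partial>measure_pmf \<mu> \<partial>measure_pmf \<mu>')"
  proof (rule nn_integral_cong)
    fix t
    show "R (y - t) = (\<integral>\<^sup>+s. of_bool (t \<le> y \<and> y < s + t) \<partial>measure_pmf \<mu>)"
    proof (cases "t \<le> y")
      case True
      then have "R (y - t) = (\<integral>\<^sup>+s. of_bool (s \<in> {y - t + 1..}) \<partial>measure_pmf \<mu>)"
        unfolding R_def ind[symmetric] by simp
      also have "(\<lambda>s. of_bool (s \<in> {y - t + 1..})) = (\<lambda>s. of_bool (t \<le> y \<and> y < s + t) :: ennreal)"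
        using True by (intro ext arg_cong[where f = of_bool]) auto
      finally show ?thesis .
    qed (simp add: R_def)
  qed
  have "(\<integral>\<^sup>+x. osc_weight \<mu> \<mu>' x * pmf (osc_kernel \<mu> \<mu>' x) y \<partial>count_space UNIV) =
    (\<integral>\<^sup>+x. L x * pmf \<mu> (y - x) + R x * pmf \<mu>' (y - x) \<partial>count_space UNIV)"
    by (intro nn_integral_cong) (simp add: L_def R_def osc_weight_def pmf_osc_kernel)
  also have "\<dots> = (\<integral>\<^sup>+s. L (y - s) \<partial>measure_pmf \<mu>) + (\<integral>\<^sup>+t. R (y - t) \<partial>measure_pmf \<mu>')"
    by (simp add: nn_integral_add nn_integral_convolution_pmf)
  also have "\<dots> =
    (\<integral>\<^sup>+s. \<integral>\<^sup>+t. of_bool (s + t \<le> y \<and> y < s) \<partial>measure_pmf \<mu>' \<partial>measure_pmf \<mu>) +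
    (\<integral>\<^sup>+s. \<integral>\<^sup>+t. of_bool (t \<le> y \<and> y < s + t) \<partial>measure_pmf \<mu>' \<partial>measure_pmf \<mu>)"
    unfolding L R by (subst (2) nn_integral_pmf_swap) (rule refl)
  also have "\<dots> =
    (\<integral>\<^sup>+s. \<integral>\<^sup>+t. of_bool (s + t \<le> y \<and> y < s) + of_bool (t \<le> y \<and> y < s + t)
      \<partial>measure_pmf \<mu>' \<partial>measure_pmf \<mu>)"
    by (simp add: nn_integral_add)
  also have "\<dots> = (\<integral>\<^sup>+s. \<integral>\<^sup>+t. of_bool (y < s) * of_bool (t \<le> y) \<partial>measure_pmf \<mu>' \<partial>measure_pmf \<mu>)"
  proof (intro nn_integral_cong_AE AE_pmfI)
    fix s t assume "s \<in> set_pmf \<mu>" "t \<in> set_pmf \<mu>'"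
    then have "0 < s" "t < 0" using pos neg by auto
    then show "of_bool (s + t \<le> y \<and> y < s) + of_bool (t \<le> y \<and> y < s + t) =
      (of_bool (y < s) * of_bool (t \<le> y) :: ennreal)" by (auto simp: of_bool_def)
  qed
  also have "\<dots> = (\<integral>\<^sup>+s. of_bool (y < s) \<partial>measure_pmf \<mu>) * (\<integral>\<^sup>+t. of_bool (t \<le> y) \<partial>measure_pmf \<mu>')"
    by (subst nn_integral_cmult, simp, rule nn_integral_multc, simp)
  also have "\<dots> = emeasure \<mu> {y+1..} * emeasure \<mu>' {..y}"
    by (simp only: ind atLeast_iff atMost_iff add1_zle_eq)
  \<comment> \<open>The signs of the jumps make one factor equal to 1 on each side of zero.\<close>
  also have "\<dots> = osc_weight \<mu> \<mu>' y"
  proof (cases "y \<le> -1")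
    case True
    then have "emeasure \<mu> {y+1..} = 1"
      using pos by (intro measure_pmf.emeasure_eq_1_AE AE_pmfI) auto
    then show ?thesis using True by (simp add: osc_weight_def)
  next
    case False
    then have "emeasure \<mu>' {..y} = 1"
      using neg by (intro measure_pmf.emeasure_eq_1_AE AE_pmfI) auto
    then show ?thesis using False by (simp add: osc_weight_def)
  qed
  finally show ?thesis .
qed

text \<open>The balance at single states is summed over \<open>A\<close>, exchanging two sums of
  nonnegative terms.\<close>

lemma osc_nu_integral_kernel:
  assumes pos: "set_pmf \<mu> \<subseteq> {0<..}" and neg: "set_pmf \<mu>' \<subseteq> {..<0}"
  shows "(\<integral>\<^sup>+x. emeasure (osc_kernel \<mu> \<mu>' x) A \<partial>osc_nu \<mu> \<mu>') = emeasure (osc_nu \<mu> \<mu>') A"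
proof -
  let ?w = "osc_weight \<mu> \<mu>'" and ?k = "\<lambda>x y. ennreal (pmf (osc_kernel \<mu> \<mu>' x) y)"
  have K: "emeasure (osc_kernel \<mu> \<mu>' x) A = (\<integral>\<^sup>+y. ?k x y * indicator A y \<partial>count_space UNIV)" for x
    by (simp add: nn_integral_measure_pmf[symmetric])
  have "(\<integral>\<^sup>+x. emeasure (osc_kernel \<mu> \<mu>' x) A \<partial>osc_nu \<mu> \<mu>') =
    (\<integral>\<^sup>+x. \<integral>\<^sup>+y. ?w x * ?k x y * indicator A y \<partial>count_space UNIV \<partial>count_space UNIV)"
    by (simp add: osc_nu_eq nn_integral_density K nn_integral_cmult[symmetric] mult.assoc)
  also have "\<dots> = (\<integral>\<^sup>+y. \<integral>\<^sup>+x. ?w x * ?k x y * indicator A y \<partial>count_space UNIV \<partial>count_space UNIV)"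
    using nn_integral_fst_count_space[of "\<lambda>(x, y). ?w x * ?k x y * indicator A y"]
      nn_integral_snd_count_space[of "\<lambda>(x, y). ?w x * ?k x y * indicator A y"] by simp
  also have "\<dots> = (\<integral>\<^sup>+y. ?w y * indicator A y \<partial>count_space UNIV)"
    by (simp add: nn_integral_multc osc_weight_balance[OF pos neg])
  also have "\<dots> = emeasure (osc_nu \<mu> \<mu>') A"
    by (simp add: osc_nu_eq emeasure_density)
  finally show ?thesis .
qed

lemma invariant_measure_osc_nu:
  assumes "set_pmf \<mu> \<subseteq> {0<..}" and "set_pmf \<mu>' \<subseteq> {..<0}"
  shows "invariant_measure (osc_kernel \<mu> \<mu>') (osc_nu \<mu> \<mu>')"
  using osc_nu_integral_kernel[OF assms]
  by (simp add: invariant_measure_def closed_under_def osc_nu_eq)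

text \<open>No mass enters \<open>C\<close> from outside, so subsets of \<open>C\<close> receive the
  same inflow from \<open>C\<close> as from the whole space. The condition is imposed almost
  everywhere because null states may jump into \<open>C\<close>.\<close>

lemma invariant_measure_restrict_space:
  assumes inv: "invariant_measure K N" and C: "C \<subseteq> space N" "closed_under K C"
    and outside: "AE x in N. x \<notin> C \<longrightarrow> set_pmf (K x) \<inter> C = {}"
  shows "invariant_measure K (restrict_space N C)"
  unfolding invariant_measure_def
proof (intro conjI allI impI)
  have sets: "sets N = Pow (space N)" using inv by (simp add: invariant_measure_def)
  have space: "space (restrict_space N C) = C" using C by (auto simp: space_restrict_space)
  show "sets (restrict_space N C) = Pow (space (restrict_space N C))"
    using C by (auto simp: sets_restrict_space space sets)
  show "closed_under K (space (restrict_space N C))" using C space by simp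
  fix A assume "A \<subseteq> space (restrict_space N C)"
  then have A: "A \<subseteq> C" by (simp add: space)
  have CN: "C \<in> sets N" using C sets by auto
  have "(\<integral>\<^sup>+x. emeasure (K x) A \<partial>restrict_space N C) = (\<integral>\<^sup>+x. emeasure (K x) A * indicator C x \<partial>N)"
    using CN by (simp add: nn_integral_restrict_space)
  also have "\<dots> = (\<integral>\<^sup>+x. emeasure (K x) A \<partial>N)"
  proof (rule nn_integral_cong_AE)
    show "AE x in N. emeasure (K x) A * indicator C x = emeasure (K x) A"
      using outside
    proof eventually_elim
      case (elim x)
      show ?case
      proof (cases "x \<in> C")
        case False
        then have "emeasure (K x) A = 0" using elim A by (auto simp: emeasure_pmf_zero_iff)
        then show ?thesis by simp
      qed simp
    qed
  qed
  also have "\<dots> = emeasure N A" using inv A C by (auto simp: invariant_measure_def)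
  also have "\<dots> = emeasure (restrict_space N C) A"
    using A CN by (simp add: emeasure_restrict_space)
  finally show "(\<integral>\<^sup>+x. emeasure (K x) A \<partial>restrict_space N C) = emeasure (restrict_space N C) A" .
qed

theorem lemma2p6:
  fixes \<mu> \<mu>' :: "int pmf"
  assumes "set_pmf \<mu> \<subseteq> {0<..}"
    and "set_pmf \<mu>' \<subseteq> {..<0}"
  shows "invariant_measure (osc_kernel \<mu> \<mu>') (osc_nu \<mu> \<mu>') \<and>
    (\<forall>x0::int.
       essential_class (osc_kernel \<mu> \<mu>')
         (irreducible_class (osc_kernel \<mu> \<mu>') (x0 mod osc_delta \<mu> \<mu>')) \<and>
       invariant_measure (osc_kernel \<mu> \<mu>')
         (restrict_space (osc_nu \<mu> \<mu>')
            (irreducible_class (osc_kernel \<mu> \<mu>') (x0 mod osc_delta \<mu> \<mu>'))))"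
proof (intro conjI allI)
  show inv: "invariant_measure (osc_kernel \<mu> \<mu>') (osc_nu \<mu> \<mu>')"
    using assms by (rule invariant_measure_osc_nu)
  fix x0 :: int
  let ?K = "osc_kernel \<mu> \<mu>'"
  define r where "r = x0 mod osc_delta \<mu> \<mu>'"
  have r: "r \<in> osc_window \<mu> \<mu>'" unfolding r_def using assms by (rule mod_osc_delta_in_window)
  note C = irreducible_class_osc[OF assms r]
  have window: "z \<in> osc_window \<mu> \<mu>'" if "x \<in> osc_window \<mu> \<mu>'" "z \<in> set_pmf (?K x)" for x z
    using osc_window_closed[OF assms] that by (auto simp: closed_under_def)
  \<comment> \<open>Read forwards this keeps the walk in the class; read backwards it prevents entry
    from another residue class.\<close>
  have residue: "osc_delta \<mu> \<mu>' dvd z - r \<longleftrightarrow> osc_delta \<mu> \<mu>' dvd x - r" if "z \<in> set_pmf (?K x)" for x z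
    using dvd_add_right_iff[OF osc_delta_dvd_step[OF that], of "x - r"] by simp
  have closed: "closed_under ?K (irreducible_class ?K r)"
    unfolding closed_under_def C using window residue by blast
  then show "essential_class ?K (irreducible_class ?K (x0 mod osc_delta \<mu> \<mu>'))"
    by (auto simp: essential_class_def r_def)
  \<comment> \<open>States outside the window can jump into the class, but they are null for
    \<open>osc_nu\<close>; window states outside the class have another residue.\<close>
  have "AE x in osc_nu \<mu> \<mu>'. x \<in> osc_window \<mu> \<mu>'"
    unfolding osc_nu_eq
    by (subst AE_density)
      (simp_all add: AE_count_space zero_less_iff_neq_zero osc_weight_nonzero_iff[OF assms])
  then have "AE x in osc_nu \<mu> \<mu>'. x \<notin> irreducible_class ?K r \<longrightarrow>
      set_pmf (?K x) \<inter> irreducible_class ?K r = {}"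
    by eventually_elim (use residue in \<open>auto simp: C\<close>)
  then have "invariant_measure ?K (restrict_space (osc_nu \<mu> \<mu>') (irreducible_class ?K r))"
    by (intro invariant_measure_restrict_space inv closed) (simp_all add: osc_nu_eq)
  then show "invariant_measure ?K
      (restrict_space (osc_nu \<mu> \<mu>') (irreducible_class ?K (x0 mod osc_delta \<mu> \<mu>')))"
    by (simp add: r_def)
qed

end
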